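(* Let $r\ge 0$ be an integer, $\mu_r\in\mathbb{C}$, and write $r=2r'$ or $r=2r'+1$ with $r'\ge0$ an integer. Let $\lambda^{tX}_{n,m}$ be the coefficients in $P^{t}_n(\mu_r;r)(x)=\sum_{m=0}^{n}\lambda^{tX}_{n,m}x^m$. Then: \begin{enumerate} \item For $0\le k\le r$: $\lambda^{tX}_{k,\nu}=C_{k,\nu}$, $0\le\nu\le k$. \item For $r'+1\le k'\le r$ (for $r=2r'$ or $r=2r'+1$): $$\lambda^{tX}_{2k',2\nu}=C_{2k',2\nu},\quad 0\le\nu\le k',$$ $$\lambda^{tX}_{2k',2\nu+1}=-\frac{\mu_r}{4^{k'-1}}\sum_{j=r-k'}^{k'-1}4^{j}C_{2j+1,2\nu+1},\quad 0\le\nu\le r-k',$$ $$\lambda^{tX}_{2k',2\nu+1}=-\frac{\mu_r}{4^{k'-1}}\sum_{j=\nu}^{k'-1}4^{j}C_{2j+1,2\nu+1},\quad r-k'+1\le\nu\le k'-1.$$ \item For $r'\le k'\le r-1$ if $r=2r'$, or for $r'+1\le k'\le r-1$ if $r=2r'+1$: $$\lambda^{tX}_{2k'+1,2\nu+1}=C_{2k'+1,2\nu+1},\quad 0\le\nu\le k',$$ $$\lambda^{tX}_{2k'+1,2\nu}=-\frac{\mu_r}{4^{k'}}\sum_{j=r-k'}^{k'}4^{j}C_{2j,2\nu},\quad 0\le\nu\le r-k',$$ $$\lambda^{tX}_{2k'+1,2\nu}=-\frac{\mu_r}{4^{k'}}\sum_{j=\nu}^{k'}4^{j}C_{2j,2\nu},\quad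 r-k'+1\le\nu\le k'.$$ \item For $n\ge 0$: $$\lambda^{tX}_{2(n+r)+1,2\nu+1}=C_{2(n+r)+1,2\nu+1},\quad 0\le\nu\le n+r,$$ $$\lambda^{tX}_{2(n+r)+1,2\nu}=-\frac{\mu_r}{4^{n+r}}\sum_{j=n}^{n+r}4^{j}C_{2j,2\nu},\quad 0\le\nu\le n,$$ $$\lambda^{tX}_{2(n+r)+1,2\nu}=-\frac{\mu_r}{4^{n+r}}\sum_{j=\nu}^{n+r}4^{j}C_{2j,2\nu},\quad n+1\le\nu\le n+r,$$ $$\lambda^{tX}_{2(n+r+1),2\nu}=C_{2(n+r+1),2\nu},\quad 0\le\nu\le n+r+1,$$ $$\lambda^{tX}_{2(n+r+1),2\nu+1}=-\frac{\mu_r}{4^{n+r}}\sum_{j=n}^{n+r}4^{j}C_{2j+1,2\nu+1},\quad 0\le\nu\le n,$$ $$\lambda^{tX}_{2(n+r+1),2\nu+1}=-\frac{\mu_r}{4^{n+r}}\sum_{j=\nu}^{n+r}4^{j}C_{2j+1,2\nu+1},\quad n+1\le\nu\le n+r.$$ \end{enumerate}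
   Context: $\{P_n\}_{n\ge0}$ denotes the monic Chebyshev polynomials of the second kind: $P_0=1$, $P_1=x$, $P_{n+2}(x)=xP_{n+1}(x)-\frac14P_n(x)$ for $n\ge 0$, and $C_{n,m}$ denotes the coefficient of $x^m$ in $P_n$, i.e. $P_n(x)=\sum_{m=0}^nC_{n,m}x^m$. For an integer $r\ge 0$ and $\mu_r\in\mathbb{C}$, the $r$th-perturbed sequence by translation $\{P^t_n(\mu_r;r)\}_{n\ge 0}$ is the monic sequence with $P^t_0=1$, $P^t_1(x)=x-\beta_0$, $P^t_{n+2}(x)=(x-\beta_{n+1})P^t_{n+1}(x)-\frac14P^t_n(x)$ for $n\ge 0$, where $\beta_r=\mu_r$ and $\beta_n=0$ for $n\ne r$. Index ranges whose upper bound is smaller than the lower bound are empty. *)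

theory Defs
  imports Complex_Main "HOL-Computational_Algebra.Polynomial"
begin

text \<open>In terms of the usual \<open>U\<^sub>n\<close>, this is \<open>U\<^sub>n / 2 ^ n\<close>.\<close>

fun monic_cheb_U :: "nat \<Rightarrow> complex poly" where
  "monic_cheb_U 0 = 1"
| "monic_cheb_U (Suc 0) = [:0, 1:]"
| "monic_cheb_U (Suc (Suc n)) = [:0, 1:] * monic_cheb_U (Suc n) - smult (1 / 4) (monic_cheb_U n)"

definition cheb_coeff :: "nat \<Rightarrow> nat \<Rightarrow> complex" where
  "cheb_coeff n m = coeff (monic_cheb_U n) m"

definition transl_beta :: "complex \<Rightarrow> nat \<Rightarrow> nat \<Rightarrow> complex" where
  "transl_beta \<mu> r n = (if n = r then \<mu> else 0)"

text \<open>The linear factor \<open>[:- b, 1:]\<close> is the polynomial \<open>x - b\<close>.\<close>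

fun perturbed_transl :: "complex \<Rightarrow> nat \<Rightarrow> nat \<Rightarrow> complex poly" where
  "perturbed_transl \<mu> r 0 = 1"
| "perturbed_transl \<mu> r (Suc 0) = [:- transl_beta \<mu> r 0, 1:]"
| "perturbed_transl \<mu> r (Suc (Suc n)) =
     [:- transl_beta \<mu> r (Suc n), 1:] * perturbed_transl \<mu> r (Suc n)
       - smult (1 / 4) (perturbed_transl \<mu> r n)"

definition transl_coeff :: "complex \<Rightarrow> nat \<Rightarrow> nat \<Rightarrow> nat \<Rightarrow> complex" where
  "transl_coeff \<mu> r n m = coeff (perturbed_transl \<mu> r n) m"

end

theory Submission
  imports Defs
begin

text \<open>
  Changing the recurrence coefficient of index \<open>r\<close> changes the solution from index \<open>r + 1\<close> on by
  \<open>- \<mu> P\<^sub>r\<close> times the solution restarted there, so \<open>P\<^sup>t\<^sub>r\<^sub>+\<^sub>1\<^sub>+\<^sub>s = P\<^sub>r\<^sub>+\<^sub>1\<^sub>+\<^sub>s - \<mu> P\<^sub>s P\<^sub>r\<close>. The addition formula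
  \<open>P\<^sub>m\<^sub>+\<^sub>1 P\<^sub>k\<^sub>+\<^sub>1 = P\<^sub>m\<^sub>+\<^sub>k\<^sub>+\<^sub>2 + P\<^sub>m P\<^sub>k / 4\<close> linearizes the product, and the cases of the theorem come from the
  parity of \<open>P\<^sub>n\<close> and from whether \<open>s\<close> or \<open>r\<close> is the smaller index.
\<close>

text \<open>By the recurrence, the right-hand side keeps its value when one unit passes from
  \<open>k\<close> to \<open>m\<close>; at \<open>m = 0\<close> it is the recurrence itself.\<close>

lemma monic_cheb_U_add:
  "monic_cheb_U (m + k + 2)
     = monic_cheb_U (Suc m) * monic_cheb_U (Suc k) - smult (1 / 4) (monic_cheb_U m * monic_cheb_U k)"
proof (induction m arbitrary: k)
  case 0
  show ?case by simp
next
  case (Suc m)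
  have "monic_cheb_U (Suc m + k + 2) = monic_cheb_U (m + Suc k + 2)"
    by simp
  also have "\<dots> = monic_cheb_U (Suc m) * monic_cheb_U (Suc (Suc k))
      - smult (1 / 4) (monic_cheb_U m * monic_cheb_U (Suc k))"
    by (rule Suc.IH)
  also have "\<dots> = monic_cheb_U (Suc (Suc m)) * monic_cheb_U (Suc k)
      - smult (1 / 4) (monic_cheb_U (Suc m) * monic_cheb_U k)"
    by (simp add: algebra_simps)
  finally show ?case .
qed

text \<open>Each use of the addition formula lowers both indices by one at the cost of a factor 1/4,
  until the smaller index is 0; the powers of 4 clear these denominators.\<close>

lemma monic_cheb_U_mult:
  "smult (4 ^ m) (monic_cheb_U m * monic_cheb_U (m + d))
     = (\<Sum>i\<le>m. smult (4 ^ i) (monic_cheb_U (2 * i + d)))"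
proof (induction m)
  case 0
  show ?case by simp
next
  case (Suc m)
  have "monic_cheb_U (Suc m) * monic_cheb_U (Suc m + d)
      = monic_cheb_U (2 * Suc m + d) + smult (1 / 4) (monic_cheb_U m * monic_cheb_U (m + d))"
    using monic_cheb_U_add[of m "m + d"] by (simp add: mult_2 add.assoc del: monic_cheb_U.simps)
  then have "smult (4 ^ Suc m) (monic_cheb_U (Suc m) * monic_cheb_U (Suc m + d))
      = smult (4 ^ Suc m) (monic_cheb_U (2 * Suc m + d))
        + smult (4 ^ m) (monic_cheb_U m * monic_cheb_U (m + d))"
    by (simp only: smult_add_right smult_smult) simp
  then show ?case
    using Suc.IH by (simp del: monic_cheb_U.simps add: add.commute)
qed

text \<open>The substitution \<open>j = i + a\<close>, \<open>d = 2 * a + e\<close> centres the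
  product: the indices add up to \<open>2 * M + e\<close>, and \<open>j\<close> runs over ranges of
  the kind the theorem uses, with \<open>e\<close> (later 0 or 1) fixing the parity.\<close>

lemma monic_cheb_U_mult':
  assumes "a \<le> M"
  shows "smult (4 ^ M) (monic_cheb_U (M - a) * monic_cheb_U (M + a + e))
     = (\<Sum>j=a..M. smult (4 ^ j) (monic_cheb_U (2 * j + e)))"
proof -
  obtain m where M: "M = m + a"
    using assms by (metis le_add_diff_inverse2)
  have "smult (4 ^ M) (monic_cheb_U (M - a) * monic_cheb_U (M + a + e))
      = smult (4 ^ a) (smult (4 ^ m) (monic_cheb_U m * monic_cheb_U (m + (2 * a + e))))"
  proof -
    have "M - a = m" "M + a + e = m + (2 * a + e)"
      by (simp_all add: M)
    then show ?thesis
      by (simp only: smult_smult) (simp add: M power_add mult.commute)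
  qed
  also have "\<dots> = (\<Sum>i\<le>m. smult (4 ^ (i + a)) (monic_cheb_U (2 * (i + a) + e)))"
    unfolding monic_cheb_U_mult
    by (intro poly_eqI) (simp add: coeff_sum sum_distrib_left power_add algebra_simps)
  also have "\<dots> = (\<Sum>j=a..M. smult (4 ^ j) (monic_cheb_U (2 * j + e)))"
    using sum.shift_bounds_cl_nat_ivl[of "\<lambda>j. smult (4 ^ j) (monic_cheb_U (2 * j + e))" 0 a m]
    by (simp add: M atMost_atLeast0)
  finally show ?thesis .
qed

lemma cheb_coeff_parity: "odd (n + m) \<Longrightarrow> cheb_coeff n m = 0"
proof (induction n arbitrary: m rule: monic_cheb_U.induct)
  case (3 n)
  have "coeff (monic_cheb_U n) m = 0"
    using 3 by (simp add: cheb_coeff_def)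
  moreover have "coeff (monic_cheb_U (Suc n)) (m - 1) = 0" if "m > 0"
    using 3 that by (simp add: cheb_coeff_def)
  ultimately show ?case
    by (cases m) (simp_all add: cheb_coeff_def coeff_pCons)
qed (auto simp: cheb_coeff_def coeff_pCons coeff_1 intro: Nat.gr0I split: nat.splits)

lemma cheb_coeff_eq_0: "n < m \<Longrightarrow> cheb_coeff n m = 0"
proof (induction n arbitrary: m rule: monic_cheb_U.induct)
  case (3 n)
  then show ?case
    by (cases m) (simp_all add: cheb_coeff_def coeff_pCons)
qed (auto simp: cheb_coeff_def coeff_pCons split: nat.splits)

text \<open>The coefficient of index \<open>r\<close> first enters when the polynomial of index
  \<open>r + 1\<close> is formed.\<close>

lemma perturbed_transl_eq_monic_cheb_U: "k \<le> r \<Longrightarrow> perturbed_transl \<mu> r k = monic_cheb_U k"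
  by (induction k rule: monic_cheb_U.induct) (auto simp: transl_beta_def)

text \<open>As functions of \<open>s\<close>, both sides satisfy the unperturbed second-order
  recurrence, so agreement at \<open>s = 0\<close> and \<open>s = 1\<close> suffices.\<close>

lemma perturbed_transl_beyond:
  "perturbed_transl \<mu> r (r + 1 + s)
     = monic_cheb_U (r + 1 + s) - smult \<mu> (monic_cheb_U s * monic_cheb_U r)"
proof -
  \<comment> \<open>The value at \<open>s = 0\<close>; the split on \<open>r\<close> is due to the
    separate defining equation for index 1.\<close>
  have base: "perturbed_transl \<mu> r (Suc r) = monic_cheb_U (Suc r) - smult \<mu> (monic_cheb_U r)"
    by (cases r) (simp_all add: perturbed_transl_eq_monic_cheb_U transl_beta_def)
  show ?thesis
  proof (induction s rule: monic_cheb_U.induct)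
    case 1
    show ?case
      by (simp add: base)
  next
    case 2
    show ?case
      by (simp add: base perturbed_transl_eq_monic_cheb_U transl_beta_def algebra_simps)
  next
    case (3 n)
    \<comment> \<open>The recurrence coefficient used here has an index above \<open>r\<close>,
      hence is zero.\<close>
    have "perturbed_transl \<mu> r (r + 1 + Suc (Suc n))
        = [:0, 1:] * perturbed_transl \<mu> r (r + 1 + Suc n)
          - smult (1 / 4) (perturbed_transl \<mu> r (r + 1 + n))"
      by (simp add: transl_beta_def)
    also have "\<dots> = [:0, 1:] * monic_cheb_U (r + 1 + Suc n) - smult (1 / 4) (monic_cheb_U (r + 1 + n))
        - smult \<mu> (([:0, 1:] * monic_cheb_U (Suc n) - smult (1 / 4) (monic_cheb_U n)) * monic_cheb_U r)"
      unfolding 3 by (simp add: smult_diff_right algebra_simps del: mult_pCons_left mult_pCons_right)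
    finally show ?case
      by simp
  qed
qed

text \<open>The two alternatives for \<open>r\<close> say whether it is the smaller or the larger
  index of the product to be linearized; since the product is symmetric, both give the same
  sum.\<close>

lemma transl_coeff_eq:
  assumes "a \<le> M" "r = M - a \<or> r = M + a + e"
  shows "transl_coeff \<mu> r (2 * M + e + 1) t = cheb_coeff (2 * M + e + 1) t
     - \<mu> / 4 ^ M * (\<Sum>j=a..M. 4 ^ j * cheb_coeff (2 * j + e) t)"
proof -
  \<comment> \<open>Either alternative gives \<open>r \<le> 2 * M + e\<close>, so this subtraction
    does not truncate.\<close>
  define s where "s = 2 * M + e - r"
  have N: "2 * M + e + 1 = r + 1 + s"
    using assms by (auto simp: s_def)
  have "monic_cheb_U s * monic_cheb_U r = monic_cheb_U (M - a) * monic_cheb_U (M + a + e)"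
    using assms(2)
  proof
    assume "r = M - a"
    moreover from this have "s = M + a + e"
      using assms(1) by (simp add: s_def)
    ultimately show ?thesis
      by (simp add: mult.commute)
  next
    assume "r = M + a + e"
    moreover from this have "s = M - a"
      by (simp add: s_def)
    ultimately show ?thesis
      by simp
  qed
  then have "smult (4 ^ M) (monic_cheb_U s * monic_cheb_U r)
      = (\<Sum>j=a..M. smult (4 ^ j) (monic_cheb_U (2 * j + e)))"
    using monic_cheb_U_mult'[OF assms(1)] by simp
  from arg_cong[where f = "\<lambda>p. coeff p t", OF this]
  have "coeff (monic_cheb_U s * monic_cheb_U r) t
      = (\<Sum>j=a..M. 4 ^ j * cheb_coeff (2 * j + e) t) / 4 ^ M"
    by (simp add: coeff_sum cheb_coeff_def eq_divide_eq mult.commute)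
  moreover have "transl_coeff \<mu> r (r + 1 + s) t
      = cheb_coeff (r + 1 + s) t - \<mu> * coeff (monic_cheb_U s * monic_cheb_U r) t"
    unfolding transl_coeff_def cheb_coeff_def perturbed_transl_beyond by simp
  ultimately show ?thesis
    unfolding N by simp
qed

text \<open>Every degree \<open>2 * j + e\<close> in the sum has the parity opposite to
  \<open>t\<close>, so the correction vanishes.\<close>

lemma transl_coeff_same_parity:
  assumes "a \<le> M" "r = M - a \<or> r = M + a + e" "odd (t + e)"
  shows "transl_coeff \<mu> r (2 * M + e + 1) t = cheb_coeff (2 * M + e + 1) t"
proof -
  have "(\<Sum>j=a..M. 4 ^ j * cheb_coeff (2 * j + e) t) = 0"
    using assms(3) by (intro sum.neutral) (simp add: cheb_coeff_parity)
  then show ?thesis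
    using transl_coeff_eq[OF assms(1,2), of \<mu> t] by simp
qed

text \<open>Now the unperturbed coefficient vanishes by parity, and only the correction
  remains.\<close>

lemma transl_coeff_other_parity:
  assumes "a \<le> M" "r = M - a \<or> r = M + a + e"
  shows "transl_coeff \<mu> r (2 * M + e + 1) (2 * \<nu> + e)
     = - (\<mu> / 4 ^ M) * (\<Sum>j=a..M. 4 ^ j * cheb_coeff (2 * j + e) (2 * \<nu> + e))"
  using transl_coeff_eq[OF assms, of \<mu> "2 * \<nu> + e"] by (simp add: cheb_coeff_parity)

text \<open>Terms with \<open>j < \<nu>\<close> ask for a coefficient above the degree, so the sum
  may start at \<open>\<nu>\<close>.\<close>

lemma transl_coeff_other_parity_truncated:
  assumes "a \<le> M" "r = M - a \<or> r = M + a + e" "a \<le> \<nu>"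
  shows "transl_coeff \<mu> r (2 * M + e + 1) (2 * \<nu> + e)
     = - (\<mu> / 4 ^ M) * (\<Sum>j=\<nu>..M. 4 ^ j * cheb_coeff (2 * j + e) (2 * \<nu> + e))"
proof -
  have "(\<Sum>j=a..M. 4 ^ j * cheb_coeff (2 * j + e) (2 * \<nu> + e))
      = (\<Sum>j=\<nu>..M. 4 ^ j * cheb_coeff (2 * j + e) (2 * \<nu> + e))"
    using assms(3) by (intro sum.mono_neutral_right) (auto simp: cheb_coeff_eq_0)
  then show ?thesis
    using transl_coeff_other_parity[OF assms(1,2), of \<mu> \<nu>] by simp
qed

theorem theorem4p2:
  fixes r r' :: nat and \<mu> :: complex
  assumes "r = 2 * r' \<or> r = 2 * r' + 1"
  shows
    "(\<forall>k \<nu>. k \<le> r \<longrightarrow> \<nu> \<le> k \<longrightarrow> transl_coeff \<mu> r k \<nu> = cheb_coeff k \<nu>)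
   \<and> (\<forall>k'. r' + 1 \<le> k' \<and> k' \<le> r \<longrightarrow>
        (\<forall>\<nu>. \<nu> \<le> k' \<longrightarrow>
           transl_coeff \<mu> r (2 * k') (2 * \<nu>) = cheb_coeff (2 * k') (2 * \<nu>))
      \<and> (\<forall>\<nu>. \<nu> \<le> r - k' \<longrightarrow>
           transl_coeff \<mu> r (2 * k') (2 * \<nu> + 1)
             = - (\<mu> / 4 ^ (k' - 1)) * (\<Sum>j = r - k'..k' - 1. 4 ^ j * cheb_coeff (2 * j + 1) (2 * \<nu> + 1)))
      \<and> (\<forall>\<nu>. r - k' + 1 \<le> \<nu> \<and> \<nu> \<le> k' - 1 \<longrightarrow>
           transl_coeff \<mu> r (2 * k') (2 * \<nu> + 1)
             = - (\<mu> / 4 ^ (k' - 1)) * (\<Sum>j = \<nu>..k' - 1. 4 ^ j * cheb_coeff (2 * j + 1) (2 * \<nu> + 1))))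
   \<and> (\<forall>k'. (r = 2 * r' \<and> r' \<le> k' \<or> r = 2 * r' + 1 \<and> r' + 1 \<le> k') \<and> k' + 1 \<le> r \<longrightarrow>
        (\<forall>\<nu>. \<nu> \<le> k' \<longrightarrow>
           transl_coeff \<mu> r (2 * k' + 1) (2 * \<nu> + 1) = cheb_coeff (2 * k' + 1) (2 * \<nu> + 1))
      \<and> (\<forall>\<nu>. \<nu> \<le> r - k' \<longrightarrow>
           transl_coeff \<mu> r (2 * k' + 1) (2 * \<nu>)
             = - (\<mu> / 4 ^ k') * (\<Sum>j = r - k'..k'. 4 ^ j * cheb_coeff (2 * j) (2 * \<nu>)))
      \<and> (\<forall>\<nu>. r - k' + 1 \<le> \<nu> \<and> \<nu> \<le> k' \<longrightarrow>
           transl_coeff \<mu> r (2 * k' + 1) (2 * \<nu>)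
             = - (\<mu> / 4 ^ k') * (\<Sum>j = \<nu>..k'. 4 ^ j * cheb_coeff (2 * j) (2 * \<nu>))))
   \<and> (\<forall>n.
        (\<forall>\<nu>. \<nu> \<le> n + r \<longrightarrow>
           transl_coeff \<mu> r (2 * (n + r) + 1) (2 * \<nu> + 1)
             = cheb_coeff (2 * (n + r) + 1) (2 * \<nu> + 1))
      \<and> (\<forall>\<nu>. \<nu> \<le> n \<longrightarrow>
           transl_coeff \<mu> r (2 * (n + r) + 1) (2 * \<nu>)
             = - (\<mu> / 4 ^ (n + r)) * (\<Sum>j = n..n + r. 4 ^ j * cheb_coeff (2 * j) (2 * \<nu>)))
      \<and> (\<forall>\<nu>. n + 1 \<le> \<nu> \<and> \<nu> \<le> n + r \<longrightarrow>
           transl_coeff \<mu> r (2 * (n + r) + 1) (2 * \<nu>)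
             = - (\<mu> / 4 ^ (n + r)) * (\<Sum>j = \<nu>..n + r. 4 ^ j * cheb_coeff (2 * j) (2 * \<nu>)))
      \<and> (\<forall>\<nu>. \<nu> \<le> n + r + 1 \<longrightarrow>
           transl_coeff \<mu> r (2 * (n + r + 1)) (2 * \<nu>)
             = cheb_coeff (2 * (n + r + 1)) (2 * \<nu>))
      \<and> (\<forall>\<nu>. \<nu> \<le> n \<longrightarrow>
           transl_coeff \<mu> r (2 * (n + r + 1)) (2 * \<nu> + 1)
             = - (\<mu> / 4 ^ (n + r)) * (\<Sum>j = n..n + r. 4 ^ j * cheb_coeff (2 * j + 1) (2 * \<nu> + 1)))
      \<and> (\<forall>\<nu>. n + 1 \<le> \<nu> \<and> \<nu> \<le> n + r \<longrightarrow>
           transl_coeff \<mu> r (2 * (n + r + 1)) (2 * \<nu> + 1)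
             = - (\<mu> / 4 ^ (n + r)) * (\<Sum>j = \<nu>..n + r. 4 ^ j * cheb_coeff (2 * j + 1) (2 * \<nu> + 1))))"
proof (intro conjI allI impI, goal_cases)
  case (1 k \<nu>)
  then show ?case
    by (simp add: transl_coeff_def cheb_coeff_def perturbed_transl_eq_monic_cheb_U)
next
  \<comment> \<open>For even degrees up to \<open>2 * r\<close>: \<open>M = k' - 1\<close>,
    \<open>a = r - k'\<close>, \<open>e = 1\<close>, with \<open>r\<close> the larger index. The
    bound \<open>r' + 1 \<le> k'\<close> gives both \<open>k' > 0\<close> and
    \<open>a \<le> M\<close>.\<close>
  case (2 k' \<nu>)
  then have "2 * (k' - 1) + 1 + 1 = 2 * k'" by arith
  with 2 show ?case
    using assms transl_coeff_same_parity[of "r - k'" "k' - 1" r 1 "2 * \<nu>" \<mu>] by auto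
next
  case (3 k' \<nu>)
  then have "2 * (k' - 1) + 1 + 1 = 2 * k'" by arith
  with 3 show ?case
    using assms transl_coeff_other_parity[of "r - k'" "k' - 1" r 1 \<mu> \<nu>] by auto
next
  case (4 k' \<nu>)
  then have "2 * (k' - 1) + 1 + 1 = 2 * k'" by arith
  with 4 show ?case
    using assms transl_coeff_other_parity_truncated[of "r - k'" "k' - 1" r 1 \<nu> \<mu>] by auto
next
  \<comment> \<open>For odd degrees below \<open>2 * r\<close>: \<open>M = k'\<close>,
    \<open>a = r - k'\<close>, \<open>e = 0\<close>, again with
    \<open>r = M + a + e\<close>.\<close>
  case (5 k' \<nu>)
  then show ?case
    using assms transl_coeff_same_parity[of "r - k'" "k'" r 0 "2 * \<nu> + 1" \<mu>] by auto
next
  case (6 k' \<nu>)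
  then show ?case
    using assms transl_coeff_other_parity[of "r - k'" "k'" r 0 \<mu> \<nu>] by auto
next
  case (7 k' \<nu>)
  then show ?case
    using assms transl_coeff_other_parity_truncated[of "r - k'" "k'" r 0 \<nu> \<mu>] by auto
next
  \<comment> \<open>From degree \<open>2 * r + 1\<close> on, \<open>r = M - a\<close> with
    \<open>M = n + r\<close> and \<open>a = n\<close>; \<open>e = 0\<close> gives the odd degrees
    and \<open>e = 1\<close> the even ones.\<close>
  case (8 n \<nu>)
  show ?case
    using transl_coeff_same_parity[of n "n + r" r 0 "2 * \<nu> + 1" \<mu>] by simp
next
  case (9 n \<nu>)
  show ?case
    using transl_coeff_other_parity[of n "n + r" r 0 \<mu> \<nu>] by simp
next
  case (10 n \<nu>)
  then show ?case
    using transl_coeff_other_parity_truncated[of n "n + r" r 0 \<nu> \<mu>] by simp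
next
  case (11 n \<nu>)
  show ?case
    using transl_coeff_same_parity[of n "n + r" r 1 "2 * \<nu>" \<mu>] by simp
next
  case (12 n \<nu>)
  show ?case
    using transl_coeff_other_parity[of n "n + r" r 1 \<mu> \<nu>] by simp
next
  case (13 n \<nu>)
  then show ?case
    using transl_coeff_other_parity_truncated[of n "n + r" r 1 \<nu> \<mu>] by simp
qed

end
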